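(* Let $G=\Lambda/\Lambda'$, let $\hat f\colon G\times G\to\mathbb C^\times$ be a non-degenerate group pairing, and equip the Hopf algebra $\mathbb C[G]$ with the $R$-matrix $$R_0=\frac1{|G|}\sum_{\mu,\nu\in G}\hat f(\mu,\nu)\,K_\mu\otimes K_\nu .$$ For a character $\chi\colon G\to\mathbb C^\times$, the one-dimensional $\mathbb C[G]$-module $\mathbb C_\chi$ is a transparent object (in the braided category of finite-dimensional $\mathbb C[G]$-modules) if and only if it is an $\hat f$-transform of the radical, i.e. $$\chi(\mu)=\hat f(\mu,\xi)\ \text{ for all }\mu\in G,\quad\text{for some }\xi\in\operatorname{Rad}_0 .$$
   Context: $\Lambda_R\subseteq\Lambda\subseteq\Lambda_W$ is a lattice between root and weight lattice of a finite-dimensional simple complex Lie algebra and $\Lambda'\subseteq\Lambda_R$ a sublattice of finite index, so $G$ is a finite abelian group; $K_\mu$ ($\mu\in G$) is the group-like basis of $\mathbb C[G]$, and $K_\mu$ acts on $\mathbb C_\chi$ by $\chi(\mu)$. The braiding is $c_{V,W}=\tau\circ R_0$ with $\tau$ the flip. An object $V$ of a braided monoidal category is transparent if $c_{W,V}\circ c_{V,W}=\operatorname{id}_{V\otimes W}$ for all objects $W$. Here $$\operatorname{Rad}_0=\{\xi\in G\mid\hat f(\xi,\nu)\hat f(\nu,\xi)=1\ \forall\nu\in G\}$$ (identified with the set of $(\xi,-\xi)$ in the antidiagonal of $G\times G$ lying in the radical of the restriction to the antidiagonal of $\operatorname{Sym}(\hat f)((\mu_1,\mu_2),(\nu_1,\nu_2))=\hat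 f(\mu_1,\nu_2)\hat f(\nu_1,\mu_2)$). *)

theory Defs
  imports Complex_Main "HOL-Algebra.Coset" "HOL-Algebra.Generated_Groups"
    "Jordan_Normal_Form.Matrix"
begin

section \<open>Simple complex Lie algebras, root and weight lattices\<close>

locale fd_complex_lie_algebra = vector_space scale
  for scale :: "complex \<Rightarrow> 'g::ab_group_add \<Rightarrow> 'g" +
  fixes bracket :: "'g \<Rightarrow> 'g \<Rightarrow> 'g"
  assumes bracket_add_left: "bracket (x + y) z = bracket x z + bracket y z"
    and bracket_add_right: "bracket x (y + z) = bracket x y + bracket x z"
    and bracket_scale_left: "bracket (scale c x) y = scale c (bracket x y)"
    and bracket_scale_right: "bracket x (scale c y) = scale c (bracket x y)"
    and bracket_self: "bracket x x = 0"
    and jacobi: "bracket x (bracket y z) + bracket y (bracket z x) + bracket z (bracket x y) = 0"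
    and finite_dim: "\<exists>B. finite B \<and> span B = UNIV"

locale simple_complex_lie_algebra = fd_complex_lie_algebra +
  assumes non_abelian: "\<exists>x y. bracket x y \<noteq> 0"
    and only_trivial_ideals:
      "subspace I \<Longrightarrow> (\<And>x y. y \<in> I \<Longrightarrow> bracket x y \<in> I) \<Longrightarrow> I = {0} \<or> I = UNIV"

text \<open>The usual definition for complex semisimple Lie algebras: an abelian, self-centralizing
  subspace all of whose elements have diagonalizable adjoint action (that is, the eigenvectors
  span the whole algebra).\<close>

definition cartan_subalgebra ::
  "(complex \<Rightarrow> 'g::ab_group_add \<Rightarrow> 'g) \<Rightarrow> ('g \<Rightarrow> 'g \<Rightarrow> 'g) \<Rightarrow> 'g set \<Rightarrow> bool" where
  "cartan_subalgebra scale bracket H \<longleftrightarrow>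
     module.subspace scale H \<and>
     (\<forall>h\<in>H. \<forall>k\<in>H. bracket h k = 0) \<and>
     (\<forall>x. (\<forall>h\<in>H. bracket h x = 0) \<longrightarrow> x \<in> H) \<and>
     (\<forall>h\<in>H. module.span scale {x. \<exists>c. bracket h x = scale c x} = UNIV)"

text \<open>Linear forms on \<open>H\<close> are represented by functions that vanish outside \<open>H\<close>, so that equality
  of forms is equality of functions.\<close>

definition dual_space ::
  "(complex \<Rightarrow> 'g::ab_group_add \<Rightarrow> 'g) \<Rightarrow> 'g set \<Rightarrow> ('g \<Rightarrow> complex) set" where
  "dual_space scale H = {l.
     (\<forall>x. x \<notin> H \<longrightarrow> l x = 0) \<and>
     (\<forall>x\<in>H. \<forall>y\<in>H. l (x + y) = l x + l y) \<and>
     (\<forall>c. \<forall>x\<in>H. l (scale c x) = c * l x)}"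

definition dual_group ::
  "(complex \<Rightarrow> 'g::ab_group_add \<Rightarrow> 'g) \<Rightarrow> 'g set \<Rightarrow> ('g \<Rightarrow> complex) monoid" where
  "dual_group scale H =
     \<lparr>carrier = dual_space scale H, monoid.mult = (\<lambda>a b x. a x + b x), one = (\<lambda>_. 0)\<rparr>"

definition root_space ::
  "(complex \<Rightarrow> 'g::ab_group_add \<Rightarrow> 'g) \<Rightarrow> ('g \<Rightarrow> 'g \<Rightarrow> 'g) \<Rightarrow> 'g set \<Rightarrow> ('g \<Rightarrow> complex) \<Rightarrow> 'g set" where
  "root_space scale bracket H a = {x. \<forall>h\<in>H. bracket h x = scale (a h) x}"

definition roots ::
  "(complex \<Rightarrow> 'g::ab_group_add \<Rightarrow> 'g) \<Rightarrow> ('g \<Rightarrow> 'g \<Rightarrow> 'g) \<Rightarrow> 'g set \<Rightarrow> ('g \<Rightarrow> complex) set" where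
  "roots scale bracket H =
     {a \<in> dual_space scale H. a \<noteq> (\<lambda>_. 0) \<and> root_space scale bracket H a \<noteq> {0}}"

text \<open>The coroot of \<open>a\<close> is the unique element \<open>c\<close> of the line \<open>[g\<^sub>a, g\<^sub>-\<^sub>a]\<close> with \<open>a(c) = 2\<close>; as the
  root spaces are one-dimensional, every element of this line is a single bracket.\<close>

definition coroot ::
  "(complex \<Rightarrow> 'g::ab_group_add \<Rightarrow> 'g) \<Rightarrow> ('g \<Rightarrow> 'g \<Rightarrow> 'g) \<Rightarrow> 'g set \<Rightarrow> ('g \<Rightarrow> complex) \<Rightarrow> 'g" where
  "coroot scale bracket H a =
     (THE c. a c = 2 \<and>
        (\<exists>x \<in> root_space scale bracket H a. \<exists>y \<in> root_space scale bracket H (\<lambda>h. - a h).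
           c = bracket x y))"

definition root_lattice ::
  "(complex \<Rightarrow> 'g::ab_group_add \<Rightarrow> 'g) \<Rightarrow> ('g \<Rightarrow> 'g \<Rightarrow> 'g) \<Rightarrow> 'g set \<Rightarrow> ('g \<Rightarrow> complex) set" where
  "root_lattice scale bracket H = generate (dual_group scale H) (roots scale bracket H)"

definition weight_lattice ::
  "(complex \<Rightarrow> 'g::ab_group_add \<Rightarrow> 'g) \<Rightarrow> ('g \<Rightarrow> 'g \<Rightarrow> 'g) \<Rightarrow> 'g set \<Rightarrow> ('g \<Rightarrow> complex) set" where
  "weight_lattice scale bracket H =
     {l \<in> dual_space scale H. \<forall>a \<in> roots scale bracket H. l (coroot scale bracket H a) \<in> \<int>}"

definition lattice_quotient ::
  "(complex \<Rightarrow> 'g::ab_group_add \<Rightarrow> 'g) \<Rightarrow> 'g set \<Rightarrow> ('g \<Rightarrow> complex) set \<Rightarrow> ('g \<Rightarrow> complex) set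
     \<Rightarrow> ('g \<Rightarrow> complex) set monoid" where
  "lattice_quotient scale H L L' = (dual_group scale H)\<lparr>carrier := L\<rparr> Mod L'"

section \<open>Characters and group pairings\<close>

definition complex_units :: "complex monoid" where
  "complex_units = \<lparr>carrier = {z. z \<noteq> 0}, monoid.mult = (*), one = 1\<rparr>"

definition is_group_pairing :: "('a, 'b) monoid_scheme \<Rightarrow> ('a \<Rightarrow> 'a \<Rightarrow> complex) \<Rightarrow> bool" where
  "is_group_pairing G f \<longleftrightarrow>
     (\<forall>\<mu> \<in> carrier G. (\<lambda>\<nu>. f \<mu> \<nu>) \<in> hom G complex_units) \<and>
     (\<forall>\<nu> \<in> carrier G. (\<lambda>\<mu>. f \<mu> \<nu>) \<in> hom G complex_units)"

definition nondegenerate_pairing :: "('a, 'b) monoid_scheme \<Rightarrow> ('a \<Rightarrow> 'a \<Rightarrow> complex) \<Rightarrow> bool" where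
  "nondegenerate_pairing G f \<longleftrightarrow>
     (\<forall>\<mu> \<in> carrier G. (\<forall>\<nu> \<in> carrier G. f \<mu> \<nu> = 1) \<longrightarrow> \<mu> = \<one>\<^bsub>G\<^esub>) \<and>
     (\<forall>\<nu> \<in> carrier G. (\<forall>\<mu> \<in> carrier G. f \<mu> \<nu> = 1) \<longrightarrow> \<nu> = \<one>\<^bsub>G\<^esub>)"

definition Rad0 :: "('a, 'b) monoid_scheme \<Rightarrow> ('a \<Rightarrow> 'a \<Rightarrow> complex) \<Rightarrow> 'a set" where
  "Rad0 G f = {\<xi> \<in> carrier G. \<forall>\<nu> \<in> carrier G. f \<xi> \<nu> * f \<nu> \<xi> = 1}"

section \<open>The group algebra and its finite-dimensional modules\<close>

definition K_basis :: "'a \<Rightarrow> 'a \<Rightarrow> complex" where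
  "K_basis \<mu> = (\<lambda>x. if x = \<mu> then 1 else 0)"

text \<open>Elements are finitely supported coefficient functions, multiplied by convolution.\<close>

definition group_algebra :: "('a, 'b) monoid_scheme \<Rightarrow> ('a \<Rightarrow> complex) ring" where
  "group_algebra G =
     \<lparr>carrier = {a. finite {x. a x \<noteq> 0} \<and> {x. a x \<noteq> 0} \<subseteq> carrier G},
      monoid.mult = (\<lambda>a b x. if x \<in> carrier G
                then \<Sum>y | a y \<noteq> 0. a y * b (inv\<^bsub>G\<^esub> y \<otimes>\<^bsub>G\<^esub> x) else 0),
      one = K_basis \<one>\<^bsub>G\<^esub>,
      zero = (\<lambda>_. 0),
      add = (\<lambda>a b x. a x + b x)\<rparr>"

text \<open>A module structure on \<open>\<complex>\<^sup>n\<close> is a unital algebra homomorphism into the \<open>n \<times> n\<close> matrices.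
  Every finite-dimensional module is isomorphic to one of this form.\<close>

definition is_module ::
  "('a, 'b) monoid_scheme \<Rightarrow> nat \<Rightarrow> (('a \<Rightarrow> complex) \<Rightarrow> complex mat) \<Rightarrow> bool" where
  "is_module G n \<rho> \<longleftrightarrow>
     \<rho> \<in> ring_hom (group_algebra G) (ring_mat TYPE(complex) n ()) \<and>
     (\<forall>c. \<forall>a \<in> carrier (group_algebra G). \<rho> (\<lambda>x. c * a x) = c \<cdot>\<^sub>m \<rho> a)"

text \<open>The one-dimensional module on which \<open>K\<^sub>\<mu>\<close> acts by the scalar \<open>\<chi> \<mu>\<close>.\<close>

definition char_module ::
  "('a, 'b) monoid_scheme \<Rightarrow> ('a \<Rightarrow> complex) \<Rightarrow> ('a \<Rightarrow> complex) \<Rightarrow> complex mat" where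
  "char_module G \<chi> a = mat 1 1 (\<lambda>_. \<Sum>\<mu> | a \<mu> \<noteq> 0. a \<mu> * \<chi> \<mu>)"

section \<open>R-matrix, braiding and transparent objects\<close>

text \<open>An element of \<open>\<complex>[G] \<otimes> \<complex>[G]\<close> is given by its coefficients at \<open>K\<^sub>\<mu> \<otimes> K\<^sub>\<nu>\<close>, as a function
  of the pair \<open>(\<mu>, \<nu>)\<close>.\<close>

definition tensor_elt :: "('a \<Rightarrow> complex) \<Rightarrow> ('a \<Rightarrow> complex) \<Rightarrow> 'a \<times> 'a \<Rightarrow> complex" where
  "tensor_elt a b = (\<lambda>(x, y). a x * b y)"

definition R0 :: "('a, 'b) monoid_scheme \<Rightarrow> ('a \<Rightarrow> 'a \<Rightarrow> complex) \<Rightarrow> 'a \<times> 'a \<Rightarrow> complex" where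
  "R0 G f = (\<lambda>p. 1 / of_nat (order G) *
     (\<Sum>\<mu> \<in> carrier G. \<Sum>\<nu> \<in> carrier G. f \<mu> \<nu> * tensor_elt (K_basis \<mu>) (K_basis \<nu>) p))"

text \<open>\<open>\<complex>\<^sup>m \<otimes> \<complex>\<^sup>n\<close> is identified with \<open>\<complex>\<^bsup>mn\<^esup>\<close> via \<open>e\<^sub>i \<otimes> e\<^sub>j \<mapsto> e\<^bsub>i n + j\<^esub>\<close> (indices start at 0), so
  that the tensor product of linear maps is the Kronecker product.\<close>

definition kronecker :: "complex mat \<Rightarrow> complex mat \<Rightarrow> complex mat" where
  "kronecker A B = mat (dim_row A * dim_row B) (dim_col A * dim_col B)
     (\<lambda>(i, j). A $$ (i div dim_row B, j div dim_col B) * B $$ (i mod dim_row B, j mod dim_col B))"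

text \<open>The flip \<open>\<complex>\<^sup>m \<otimes> \<complex>\<^sup>n \<rightarrow> \<complex>\<^sup>n \<otimes> \<complex>\<^sup>m\<close>, \<open>e\<^sub>i \<otimes> e\<^sub>j \<mapsto> e\<^sub>j \<otimes> e\<^sub>i\<close>.\<close>

definition flip :: "nat \<Rightarrow> nat \<Rightarrow> complex mat" where
  "flip m n = mat (n * m) (m * n) (\<lambda>(r, s). if r = (s mod n) * m + s div n then 1 else 0)"

text \<open>The action of an element of \<open>\<complex>[G] \<otimes> \<complex>[G]\<close> (for finite \<open>G\<close>) on \<open>V \<otimes> W\<close>, where
  \<open>V = (\<complex>\<^sup>m, \<rho>)\<close> and \<open>W = (\<complex>\<^sup>n, \<sigma>)\<close>.\<close>

definition tensor_action ::
  "('a, 'b) monoid_scheme \<Rightarrow> ('a \<times> 'a \<Rightarrow> complex) \<Rightarrow>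
   nat \<Rightarrow> (('a \<Rightarrow> complex) \<Rightarrow> complex mat) \<Rightarrow> nat \<Rightarrow> (('a \<Rightarrow> complex) \<Rightarrow> complex mat) \<Rightarrow> complex mat" where
  "tensor_action G R m \<rho> n \<sigma> = mat (m * n) (m * n) (\<lambda>ij.
     \<Sum>\<mu> \<in> carrier G. \<Sum>\<nu> \<in> carrier G.
       R (\<mu>, \<nu>) * kronecker (\<rho> (K_basis \<mu>)) (\<sigma> (K_basis \<nu>)) $$ ij)"

definition braiding ::
  "('a, 'b) monoid_scheme \<Rightarrow> ('a \<times> 'a \<Rightarrow> complex) \<Rightarrow>
   nat \<Rightarrow> (('a \<Rightarrow> complex) \<Rightarrow> complex mat) \<Rightarrow> nat \<Rightarrow> (('a \<Rightarrow> complex) \<Rightarrow> complex mat) \<Rightarrow> complex mat" where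
  "braiding G R m \<rho> n \<sigma> = flip m n * tensor_action G R m \<rho> n \<sigma>"

text \<open>The comultiplication of \<open>\<complex>[G]\<close>, which makes \<open>V \<otimes> W\<close> a module, plays no role here: the
  transparency condition is an equation between linear endomorphisms of \<open>V \<otimes> W\<close>.\<close>

definition transparent ::
  "('a, 'b) monoid_scheme \<Rightarrow> ('a \<times> 'a \<Rightarrow> complex) \<Rightarrow>
   nat \<Rightarrow> (('a \<Rightarrow> complex) \<Rightarrow> complex mat) \<Rightarrow> bool" where
  "transparent G R m \<rho> \<longleftrightarrow> is_module G m \<rho> \<and>
     (\<forall>n \<sigma>. is_module G n \<sigma> \<longrightarrow>
        braiding G R n \<sigma> m \<rho> * braiding G R m \<rho> n \<sigma> = 1\<^sub>m (m * n))"

end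

theory Submission
  imports Defs
begin

text \<open>
  Since the pairing is non-degenerate, every character \<open>\<chi>\<close> of \<open>G\<close> is a transform in either
  argument: \<open>\<chi> \<mu> = f \<mu> \<xi> = f \<zeta> \<mu>\<close> for suitable \<open>\<xi>, \<zeta> \<in> G\<close>
  (\<open>character_as_left_transform\<close>, \<open>character_as_right_transform\<close>). Letting \<open>R\<^sub>0\<close> act on
  \<open>\<complex>\<^sub>\<chi> \<otimes> W\<close> turns its first leg into a character sum, which by orthogonality picks out a
  single term of the second leg: \<open>R\<^sub>0\<close> acts as \<open>K\<^sub>\<nu>\<close> on \<open>W\<close> with \<open>\<nu> = inv \<xi>\<close>. In the same
  way it acts on \<open>W \<otimes> \<complex>\<^sub>\<chi>\<close> as \<open>K\<^sub>\<nu>\<close> with \<open>\<nu> = inv \<zeta>\<close> (\<open>braiding_character_left\<close>,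
  \<open>braiding_character_right\<close>).

  The double braiding of \<open>\<complex>\<^sub>\<chi>\<close> with an arbitrary module is therefore the action of
  \<open>inv \<zeta> \<otimes> inv \<xi>\<close>. It is the identity on all modules exactly if \<open>\<zeta> = inv \<xi>\<close>, because
  already the one-dimensional modules separate the elements of \<open>G\<close>
  (\<open>transparent_iff_transforms_inverse\<close>). Finally \<open>\<zeta> = inv \<xi>\<close> says that
  \<open>f \<nu> \<xi> = f (inv \<xi>) \<nu> = inverse (f \<xi> \<nu>)\<close> for all \<open>\<nu>\<close>, which is the condition
  \<open>\<xi> \<in> Rad0 G f\<close>. All of this holds for any finite abelian group, and
  \<open>\<Lambda> / \<Lambda>'\<close> is one (\<open>lattice_quotient_comm_group\<close>).
\<close>

section \<open>Characters of a finite group\<close>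

lemma character_mult:
  assumes "\<chi> \<in> hom G complex_units" "x \<in> carrier G" "y \<in> carrier G"
  shows "\<chi> (x \<otimes>\<^bsub>G\<^esub> y) = \<chi> x * \<chi> y"
  using assms by (auto simp: hom_def complex_units_def)

lemma character_nonzero:
  assumes "\<chi> \<in> hom G complex_units" "x \<in> carrier G"
  shows "\<chi> x \<noteq> 0"
  using assms by (auto simp: hom_def complex_units_def)

lemma hom_complex_unitsI:
  assumes "\<And>x. x \<in> carrier G \<Longrightarrow> \<chi> x \<noteq> 0"
    and "\<And>x y. x \<in> carrier G \<Longrightarrow> y \<in> carrier G \<Longrightarrow> \<chi> (x \<otimes>\<^bsub>G\<^esub> y) = \<chi> x * \<chi> y"
  shows "\<chi> \<in> hom G complex_units"
  using assms by (auto simp: hom_def complex_units_def)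

lemma (in group) character_one:
  assumes "\<chi> \<in> hom G complex_units"
  shows "\<chi> \<one> = 1"
  using character_mult[OF assms, of \<one> \<one>] character_nonzero[OF assms, of \<one>] by simp

lemma (in group) character_inv:
  assumes "\<chi> \<in> hom G complex_units" "x \<in> carrier G"
  shows "\<chi> (inv x) = inverse (\<chi> x)"
proof -
  have "\<chi> (inv x) * \<chi> x = 1"
    using character_mult[OF assms(1), of "inv x" x] assms character_one[OF assms(1)] by simp
  then show ?thesis
    using inverse_unique[of "\<chi> x" "\<chi> (inv x)"] by (simp add: mult.commute)
qed

lemma (in group) sum_translate:
  fixes h :: "'a \<Rightarrow> complex"
  assumes "y \<in> carrier G"
  shows "(\<Sum>x\<in>carrier G. h (y \<otimes> x)) = (\<Sum>x\<in>carrier G. h x)"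
  using assms
  by (intro sum.reindex_bij_witness[where i = "\<lambda>x. inv y \<otimes> x" and j = "\<lambda>x. y \<otimes> x"])
    (simp_all add: m_assoc[symmetric])

text \<open>Translating the summation variable by \<open>y\<close> multiplies the sum by \<open>\<chi> y\<close>; hence a
  single \<open>y\<close> with \<open>\<chi> y \<noteq> 1\<close> forces the sum to vanish.\<close>

lemma (in group) character_sum:
  assumes \<chi>: "\<chi> \<in> hom G complex_units"
  shows "(\<Sum>x\<in>carrier G. \<chi> x) = (if \<forall>x\<in>carrier G. \<chi> x = 1 then of_nat (order G) else 0)"
proof (cases "\<forall>x\<in>carrier G. \<chi> x = 1")
  case True
  then show ?thesis by (simp add: order_def)
next
  case False
  then obtain y where y: "y \<in> carrier G" "\<chi> y \<noteq> 1" by blast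
  have "\<chi> y * (\<Sum>x\<in>carrier G. \<chi> x) = (\<Sum>x\<in>carrier G. \<chi> (y \<otimes> x))"
    using y \<chi> by (simp add: sum_distrib_left character_mult)
  also have "\<dots> = (\<Sum>x\<in>carrier G. \<chi> x)"
    by (rule sum_translate[OF y(1)])
  finally have "(\<chi> y - 1) * (\<Sum>x\<in>carrier G. \<chi> x) = 0"
    by (simp add: algebra_simps)
  then show ?thesis using y False by auto
qed

section \<open>Fourier transform for a non-degenerate pairing\<close>

locale finite_group_pairing = comm_group G for G (structure) +
  fixes f :: "'a \<Rightarrow> 'a \<Rightarrow> complex"
  assumes fin: "finite (carrier G)"
    and pairing: "is_group_pairing G f"
    and nondegenerate: "nondegenerate_pairing G f"
begin

lemma flipped_pairing: "finite_group_pairing G (\<lambda>\<mu> \<nu>. f \<nu> \<mu>)"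
  using fin pairing nondegenerate
  by unfold_locales (auto simp: is_group_pairing_def nondegenerate_pairing_def)

lemma hom_right: "\<mu> \<in> carrier G \<Longrightarrow> (\<lambda>\<nu>. f \<mu> \<nu>) \<in> hom G complex_units"
  using pairing by (simp add: is_group_pairing_def)

lemma hom_left: "\<nu> \<in> carrier G \<Longrightarrow> (\<lambda>\<mu>. f \<mu> \<nu>) \<in> hom G complex_units"
  using pairing by (simp add: is_group_pairing_def)

lemma order_nonzero: "(of_nat (order G) :: complex) \<noteq> 0"
  using order_gt_0_iff_finite fin by simp

lemma sum_right:
  assumes "\<mu> \<in> carrier G"
  shows "(\<Sum>\<nu>\<in>carrier G. f \<mu> \<nu>) = (if \<mu> = \<one> then of_nat (order G) else 0)"
proof -
  have "(\<forall>\<nu>\<in>carrier G. f \<mu> \<nu> = 1) \<longleftrightarrow> \<mu> = \<one>"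
    using nondegenerate assms character_one[OF hom_left]
    by (auto simp: nondegenerate_pairing_def)
  then show ?thesis
    using character_sum[OF hom_right[OF assms]] by simp
qed

lemma sum_left:
  assumes "\<nu> \<in> carrier G"
  shows "(\<Sum>\<mu>\<in>carrier G. f \<mu> \<nu>) = (if \<nu> = \<one> then of_nat (order G) else 0)"
  using finite_group_pairing.sum_right[OF flipped_pairing assms] .

text \<open>Fourier inversion at the neutral element: the coefficients
  \<open>\<Sum>\<mu>. \<chi> \<mu> * f \<mu> \<nu>\<close> add up to \<open>order G * \<chi> \<one> \<noteq> 0\<close>, so one of them is nonzero. By
  orthogonality the corresponding character \<open>\<lambda>\<mu>. \<chi> \<mu> * f \<mu> \<nu>\<close> is trivial, and \<open>inv \<nu>\<close>
  represents \<open>\<chi>\<close>.\<close>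

lemma character_as_left_transform:
  assumes \<chi>: "\<chi> \<in> hom G complex_units"
  obtains \<xi> where "\<xi> \<in> carrier G" "\<And>\<mu>. \<mu> \<in> carrier G \<Longrightarrow> \<chi> \<mu> = f \<mu> \<xi>"
proof -
  have "(\<Sum>\<nu>\<in>carrier G. \<Sum>\<mu>\<in>carrier G. \<chi> \<mu> * f \<mu> \<nu>) =
        (\<Sum>\<mu>\<in>carrier G. \<chi> \<mu> * (\<Sum>\<nu>\<in>carrier G. f \<mu> \<nu>))"
    by (subst sum.swap) (simp add: sum_distrib_left)
  also have "\<dots> = (\<Sum>\<mu>\<in>carrier G. if \<mu> = \<one> then \<chi> \<mu> * of_nat (order G) else 0)"
    by (rule sum.cong) (auto simp: sum_right)
  also have "\<dots> = of_nat (order G)"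
    using fin character_one[OF \<chi>] by simp
  finally have "(\<Sum>\<nu>\<in>carrier G. \<Sum>\<mu>\<in>carrier G. \<chi> \<mu> * f \<mu> \<nu>) \<noteq> 0"
    using order_nonzero by simp
  then obtain \<nu> where \<nu>: "\<nu> \<in> carrier G" "(\<Sum>\<mu>\<in>carrier G. \<chi> \<mu> * f \<mu> \<nu>) \<noteq> 0"
    by (meson sum.not_neutral_contains_not_neutral)
  have "(\<lambda>\<mu>. \<chi> \<mu> * f \<mu> \<nu>) \<in> hom G complex_units"
    using character_mult[OF \<chi>] character_mult[OF hom_left[OF \<nu>(1)]]
      character_nonzero[OF \<chi>] character_nonzero[OF hom_left[OF \<nu>(1)]]
    by (intro hom_complex_unitsI) auto
  from character_sum[OF this] \<nu>(2) have triv: "\<forall>\<mu>\<in>carrier G. \<chi> \<mu> * f \<mu> \<nu> = 1"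
    by (auto split: if_splits)
  show thesis
  proof
    show "inv \<nu> \<in> carrier G" using \<nu> by simp
    fix \<mu> assume \<mu>: "\<mu> \<in> carrier G"
    have "f \<mu> (inv \<nu>) = inverse (f \<mu> \<nu>)"
      using character_inv[OF hom_right[OF \<mu>] \<nu>(1)] .
    moreover have "f \<mu> \<nu> * \<chi> \<mu> = 1"
      using triv \<mu> by (simp add: mult.commute)
    ultimately show "\<chi> \<mu> = f \<mu> (inv \<nu>)"
      by (simp add: inverse_unique)
  qed
qed

lemma character_as_right_transform:
  assumes "\<chi> \<in> hom G complex_units"
  obtains \<zeta> where "\<zeta> \<in> carrier G" "\<And>\<nu>. \<nu> \<in> carrier G \<Longrightarrow> \<chi> \<nu> = f \<zeta> \<nu>"
  using finite_group_pairing.character_as_left_transform[OF flipped_pairing assms] by blast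

text \<open>These sums arise when one leg of \<open>R\<^sub>0\<close> acts on \<open>\<complex>\<^sub>\<chi>\<close>: what remains in the other leg is a
  single group element.\<close>

lemma left_transform_orthogonality:
  assumes \<xi>: "\<xi> \<in> carrier G" and \<chi>: "\<And>\<mu>. \<mu> \<in> carrier G \<Longrightarrow> \<chi> \<mu> = f \<mu> \<xi>"
    and \<nu>: "\<nu> \<in> carrier G"
  shows "(\<Sum>\<mu>\<in>carrier G. f \<mu> \<nu> * \<chi> \<mu>) = (if \<nu> = inv \<xi> then of_nat (order G) else 0)"
proof -
  have "(\<Sum>\<mu>\<in>carrier G. f \<mu> \<nu> * \<chi> \<mu>) = (\<Sum>\<mu>\<in>carrier G. f \<mu> (\<nu> \<otimes> \<xi>))"
    using \<chi> \<nu> \<xi> character_mult[OF hom_right] by (intro sum.cong) auto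
  moreover have "\<nu> \<otimes> \<xi> = \<one> \<longleftrightarrow> \<nu> = inv \<xi>"
    using \<nu> \<xi> inv_equality by auto
  ultimately show ?thesis using sum_left \<nu> \<xi> by simp
qed

lemma right_transform_orthogonality:
  assumes "\<zeta> \<in> carrier G" "\<And>\<nu>. \<nu> \<in> carrier G \<Longrightarrow> \<chi> \<nu> = f \<zeta> \<nu>" "\<mu> \<in> carrier G"
  shows "(\<Sum>\<nu>\<in>carrier G. f \<mu> \<nu> * \<chi> \<nu>) = (if \<mu> = inv \<zeta> then of_nat (order G) else 0)"
  using finite_group_pairing.left_transform_orthogonality[OF flipped_pairing assms] .

end

section \<open>Modules over the group algebra\<close>

lemma K_basis_support: "{x. K_basis \<mu> x \<noteq> 0} = {\<mu>}"
  by (auto simp: K_basis_def)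

lemma K_basis_carrier: "\<mu> \<in> carrier G \<Longrightarrow> K_basis \<mu> \<in> carrier (group_algebra G)"
  by (simp add: group_algebra_def K_basis_support)

lemma (in group) K_basis_mult:
  assumes "\<mu> \<in> carrier G" "\<nu> \<in> carrier G"
  shows "K_basis \<mu> \<otimes>\<^bsub>group_algebra G\<^esub> K_basis \<nu> = K_basis (\<mu> \<otimes> \<nu>)"
proof
  fix x
  have "inv \<mu> \<otimes> x = \<nu> \<longleftrightarrow> x = \<mu> \<otimes> \<nu>" if "x \<in> carrier G"
    using inv_solve_left[of x \<mu> \<nu>] inv_solve_left'[of \<nu> \<mu> x] assms that by auto
  then show "(K_basis \<mu> \<otimes>\<^bsub>group_algebra G\<^esub> K_basis \<nu>) x = K_basis (\<mu> \<otimes> \<nu>) x"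
    using assms by (auto simp: group_algebra_def K_basis_support) (auto simp: K_basis_def)
qed

lemma is_module_K_carrier:
  assumes "is_module G n \<sigma>" "\<mu> \<in> carrier G"
  shows "\<sigma> (K_basis \<mu>) \<in> carrier_mat n n"
  using assms K_basis_carrier[of \<mu> G]
  by (auto simp: is_module_def ring_hom_def ring_mat_def)

lemma (in group) is_module_K_mult:
  assumes "is_module G n \<sigma>" "\<mu> \<in> carrier G" "\<nu> \<in> carrier G"
  shows "\<sigma> (K_basis \<mu>) * \<sigma> (K_basis \<nu>) = \<sigma> (K_basis (\<mu> \<otimes> \<nu>))"
proof -
  have "\<sigma> (K_basis \<mu> \<otimes>\<^bsub>group_algebra G\<^esub> K_basis \<nu>) = \<sigma> (K_basis \<mu>) * \<sigma> (K_basis \<nu>)"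
    using assms K_basis_carrier[of \<mu> G] K_basis_carrier[of \<nu> G]
    by (auto simp: is_module_def ring_hom_def ring_mat_def)
  then show ?thesis using K_basis_mult[OF assms(2,3)] by simp
qed

lemma is_module_K_one:
  assumes "is_module G n \<sigma>"
  shows "\<sigma> (K_basis \<one>\<^bsub>G\<^esub>) = 1\<^sub>m n"
  using assms by (auto simp: is_module_def ring_hom_def ring_mat_def group_algebra_def)

lemma char_module_K_basis: "char_module G \<chi> (K_basis \<mu>) = mat 1 1 (\<lambda>_. \<chi> \<mu>)"
  by (simp add: char_module_def K_basis_support) (simp add: K_basis_def)

lemma char_module_eq:
  assumes "finite (carrier G)" "\<And>x. x \<notin> carrier G \<Longrightarrow> a x = 0"
  shows "char_module G \<chi> a = mat 1 1 (\<lambda>_. \<Sum>\<mu>\<in>carrier G. a \<mu> * \<chi> \<mu>)"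
proof -
  have "(\<Sum>\<mu> | a \<mu> \<noteq> 0. a \<mu> * \<chi> \<mu>) = (\<Sum>\<mu>\<in>carrier G. a \<mu> * \<chi> \<mu>)"
    using assms by (intro sum.mono_neutral_left) auto
  then show ?thesis by (simp add: char_module_def)
qed

lemma (in group) group_algebra_mult:
  assumes "finite (carrier G)" "a \<in> carrier (group_algebra G)"
  shows "(a \<otimes>\<^bsub>group_algebra G\<^esub> b) x =
    (if x \<in> carrier G then \<Sum>y\<in>carrier G. a y * b (inv y \<otimes> x) else 0)"
proof -
  have "(\<Sum>y | a y \<noteq> 0. a y * b (inv y \<otimes> x)) = (\<Sum>y\<in>carrier G. a y * b (inv y \<otimes> x))"
    using assms by (intro sum.mono_neutral_left) (auto simp: group_algebra_def)
  then show ?thesis by (simp add: group_algebra_def)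
qed

text \<open>Multiplicativity is the statement that a character turns convolution into a product:
  substitute \<open>x = y \<otimes> z\<close> in the double sum.\<close>

lemma (in group) char_module_is_module:
  assumes fin: "finite (carrier G)" and \<chi>: "\<chi> \<in> hom G complex_units"
  shows "is_module G 1 (char_module G \<chi>)"
proof -
  let ?A = "group_algebra G"
  have supp: "a x = 0" if "a \<in> carrier ?A" "x \<notin> carrier G" for a x
    using that by (auto simp: group_algebra_def)
  have val: "char_module G \<chi> a = mat 1 1 (\<lambda>_. \<Sum>\<mu>\<in>carrier G. a \<mu> * \<chi> \<mu>)"
    if "a \<in> carrier ?A" for a
    using char_module_eq[OF fin] supp that by blast
  have mult: "char_module G \<chi> (a \<otimes>\<^bsub>?A\<^esub> b) = char_module G \<chi> a * char_module G \<chi> b"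
    if a: "a \<in> carrier ?A" and b: "b \<in> carrier ?A" for a b
  proof -
    have "(\<Sum>x\<in>carrier G. (a \<otimes>\<^bsub>?A\<^esub> b) x * \<chi> x) =
          (\<Sum>x\<in>carrier G. \<Sum>y\<in>carrier G. a y * b (inv y \<otimes> x) * \<chi> x)"
      by (simp add: group_algebra_mult[OF fin a] sum_distrib_right)
    also have "\<dots> = (\<Sum>y\<in>carrier G. \<Sum>x\<in>carrier G. a y * b (inv y \<otimes> x) * \<chi> x)"
      by (rule sum.swap)
    also have "\<dots> = (\<Sum>y\<in>carrier G. \<Sum>z\<in>carrier G. (a y * \<chi> y) * (b z * \<chi> z))"
    proof (rule sum.cong[OF refl])
      fix y assume y: "y \<in> carrier G"
      have "(\<Sum>x\<in>carrier G. a y * b (inv y \<otimes> x) * \<chi> x) =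
            (\<Sum>z\<in>carrier G. a y * b (inv y \<otimes> (y \<otimes> z)) * \<chi> (y \<otimes> z))"
        using sum_translate[OF y, of "\<lambda>x. a y * b (inv y \<otimes> x) * \<chi> x"] by simp
      also have "\<dots> = (\<Sum>z\<in>carrier G. (a y * \<chi> y) * (b z * \<chi> z))"
        using y character_mult[OF \<chi>] by (intro sum.cong) (auto simp: m_assoc[symmetric])
      finally show "(\<Sum>x\<in>carrier G. a y * b (inv y \<otimes> x) * \<chi> x) =
        (\<Sum>z\<in>carrier G. (a y * \<chi> y) * (b z * \<chi> z))" .
    qed
    also have "\<dots> = (\<Sum>y\<in>carrier G. a y * \<chi> y) * (\<Sum>z\<in>carrier G. b z * \<chi> z)"
      by (simp add: sum_product)
    finally have "(\<Sum>x\<in>carrier G. (a \<otimes>\<^bsub>?A\<^esub> b) x * \<chi> x) =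
      (\<Sum>y\<in>carrier G. a y * \<chi> y) * (\<Sum>z\<in>carrier G. b z * \<chi> z)" .
    moreover have "char_module G \<chi> (a \<otimes>\<^bsub>?A\<^esub> b) =
        mat 1 1 (\<lambda>_. \<Sum>x\<in>carrier G. (a \<otimes>\<^bsub>?A\<^esub> b) x * \<chi> x)"
      by (rule char_module_eq[OF fin]) (simp add: group_algebra_mult[OF fin a])
    ultimately show ?thesis
      by (intro eq_matI) (auto simp: val a b scalar_prod_def)
  qed
  have add: "char_module G \<chi> (a \<oplus>\<^bsub>?A\<^esub> b) = char_module G \<chi> a + char_module G \<chi> b"
    if a: "a \<in> carrier ?A" and b: "b \<in> carrier ?A" for a b
  proof -
    have "char_module G \<chi> (a \<oplus>\<^bsub>?A\<^esub> b) = mat 1 1 (\<lambda>_. \<Sum>x\<in>carrier G. (a \<oplus>\<^bsub>?A\<^esub> b) x * \<chi> x)"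
      using supp[OF a] supp[OF b] by (intro char_module_eq[OF fin]) (simp add: group_algebra_def)
    then show ?thesis
      by (intro eq_matI) (auto simp: val[OF a] val[OF b] group_algebra_def distrib_right sum.distrib)
  qed
  have one: "char_module G \<chi> \<one>\<^bsub>?A\<^esub> = 1\<^sub>m 1"
    using character_one[OF \<chi>]
    by (intro eq_matI) (auto simp: group_algebra_def char_module_K_basis)
  have smult: "char_module G \<chi> (\<lambda>x. c * a x) = c \<cdot>\<^sub>m char_module G \<chi> a"
    if a: "a \<in> carrier ?A" for c a
  proof -
    have "char_module G \<chi> (\<lambda>x. c * a x) = mat 1 1 (\<lambda>_. \<Sum>x\<in>carrier G. c * a x * \<chi> x)"
      using supp[OF a] by (intro char_module_eq[OF fin]) simp
    then show ?thesis
      by (intro eq_matI) (auto simp: val a sum_distrib_left mult.assoc)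
  qed
  have "char_module G \<chi> a \<in> carrier_mat 1 1" for a
    by (simp add: char_module_def)
  then have "char_module G \<chi> \<in> ring_hom ?A (ring_mat TYPE(complex) 1 ())"
    using mult add one by (intro ring_hom_memI) (simp_all add: ring_mat_def)
  then show ?thesis by (simp add: is_module_def smult)
qed

section \<open>Braiding with a one-dimensional module\<close>

lemma R0_coeff:
  assumes "finite (carrier G)" "\<mu> \<in> carrier G" "\<nu> \<in> carrier G"
  shows "R0 G f (\<mu>, \<nu>) = f \<mu> \<nu> / of_nat (order G)"
proof -
  have "(\<Sum>\<mu>'\<in>carrier G. \<Sum>\<nu>'\<in>carrier G.
          f \<mu>' \<nu>' * tensor_elt (K_basis \<mu>') (K_basis \<nu>') (\<mu>, \<nu>)) =
        (\<Sum>\<mu>'\<in>carrier G. \<Sum>\<nu>'\<in>carrier G. if \<nu>' = \<nu> then (if \<mu>' = \<mu> then f \<mu>' \<nu>' else 0) else 0)"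
    by (intro sum.cong) (auto simp: tensor_elt_def K_basis_def)
  also have "\<dots> = f \<mu> \<nu>"
    using assms by simp
  finally show ?thesis by (simp add: R0_def)
qed

lemma flip_one_left: "flip 1 n = 1\<^sub>m n"
  by (intro eq_matI) (auto simp: flip_def)

lemma flip_one_right: "flip n 1 = 1\<^sub>m n"
  by (intro eq_matI) (auto simp: flip_def)

lemma kronecker_scalar_left:
  assumes "B \<in> carrier_mat n n" "i < n" "j < n"
  shows "kronecker (mat 1 1 (\<lambda>_. c)) B $$ (i, j) = c * B $$ (i, j)"
  using assms by (auto simp: kronecker_def)

lemma kronecker_scalar_right:
  assumes "A \<in> carrier_mat n n" "i < n" "j < n"
  shows "kronecker A (mat 1 1 (\<lambda>_. c)) $$ (i, j) = c * A $$ (i, j)"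
  using assms by (auto simp: kronecker_def)

context finite_group_pairing
begin

text \<open>By orthogonality, \<open>R\<^sub>0\<close> acts on the tensor product of \<open>\<complex>\<^sub>\<chi>\<close> with an arbitrary module as
  a single group element. Hence the braiding with a module of any dimension is explicit without
  decomposing the module into characters.\<close>

lemma braiding_character_left:
  assumes \<sigma>: "is_module G n \<sigma>"
    and \<xi>: "\<xi> \<in> carrier G" and \<chi>: "\<And>\<mu>. \<mu> \<in> carrier G \<Longrightarrow> \<chi> \<mu> = f \<mu> \<xi>"
  shows "braiding G (R0 G f) 1 (char_module G \<chi>) n \<sigma> = \<sigma> (K_basis (inv \<xi>))"
proof -
  have car: "\<sigma> (K_basis \<nu>) \<in> carrier_mat n n" if "\<nu> \<in> carrier G" for \<nu>
    using is_module_K_carrier[OF \<sigma> that] .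
  have entry: "(\<Sum>\<mu>\<in>carrier G. \<Sum>\<nu>\<in>carrier G. R0 G f (\<mu>, \<nu>) *
      kronecker (char_module G \<chi> (K_basis \<mu>)) (\<sigma> (K_basis \<nu>)) $$ (i, j)) =
      \<sigma> (K_basis (inv \<xi>)) $$ (i, j)" if ij: "i < n" "j < n" for i j
  proof -
    let ?s = "\<lambda>\<nu>. \<sigma> (K_basis \<nu>) $$ (i, j)"
    have "(\<Sum>\<mu>\<in>carrier G. \<Sum>\<nu>\<in>carrier G. R0 G f (\<mu>, \<nu>) *
        kronecker (char_module G \<chi> (K_basis \<mu>)) (\<sigma> (K_basis \<nu>)) $$ (i, j)) =
        (\<Sum>\<mu>\<in>carrier G. \<Sum>\<nu>\<in>carrier G. (f \<mu> \<nu> * \<chi> \<mu>) * (?s \<nu> / of_nat (order G)))"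
      by (intro sum.cong refl)
        (simp add: R0_coeff fin char_module_K_basis kronecker_scalar_left[OF car ij, unfolded One_nat_def])
    also have "\<dots> = (\<Sum>\<nu>\<in>carrier G. (\<Sum>\<mu>\<in>carrier G. f \<mu> \<nu> * \<chi> \<mu>) * (?s \<nu> / of_nat (order G)))"
      by (subst sum.swap) (simp only: sum_distrib_right)
    also have "\<dots> = (\<Sum>\<nu>\<in>carrier G. if \<nu> = inv \<xi> then ?s \<nu> else 0)"
      using order_nonzero
      by (intro sum.cong refl) (simp add: left_transform_orthogonality[OF \<xi> \<chi>])
    also have "\<dots> = ?s (inv \<xi>)"
      using fin \<xi> by simp
    finally show ?thesis .
  qed
  have "tensor_action G (R0 G f) 1 (char_module G \<chi>) n \<sigma> = \<sigma> (K_basis (inv \<xi>))"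
    using car[of "inv \<xi>"] \<xi> entry
    by (intro eq_matI) (auto simp: tensor_action_def)
  then show ?thesis
    using car[of "inv \<xi>"] \<xi> by (simp add: braiding_def flip_one_left[unfolded One_nat_def])
qed

lemma braiding_character_right:
  assumes \<sigma>: "is_module G n \<sigma>"
    and \<zeta>: "\<zeta> \<in> carrier G" and \<chi>: "\<And>\<nu>. \<nu> \<in> carrier G \<Longrightarrow> \<chi> \<nu> = f \<zeta> \<nu>"
  shows "braiding G (R0 G f) n \<sigma> 1 (char_module G \<chi>) = \<sigma> (K_basis (inv \<zeta>))"
proof -
  have car: "\<sigma> (K_basis \<nu>) \<in> carrier_mat n n" if "\<nu> \<in> carrier G" for \<nu>
    using is_module_K_carrier[OF \<sigma> that] .
  have entry: "(\<Sum>\<mu>\<in>carrier G. \<Sum>\<nu>\<in>carrier G. R0 G f (\<mu>, \<nu>) *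
      kronecker (\<sigma> (K_basis \<mu>)) (char_module G \<chi> (K_basis \<nu>)) $$ (i, j)) =
      \<sigma> (K_basis (inv \<zeta>)) $$ (i, j)" if ij: "i < n" "j < n" for i j
  proof -
    let ?s = "\<lambda>\<mu>. \<sigma> (K_basis \<mu>) $$ (i, j)"
    have "(\<Sum>\<mu>\<in>carrier G. \<Sum>\<nu>\<in>carrier G. R0 G f (\<mu>, \<nu>) *
        kronecker (\<sigma> (K_basis \<mu>)) (char_module G \<chi> (K_basis \<nu>)) $$ (i, j)) =
        (\<Sum>\<mu>\<in>carrier G. \<Sum>\<nu>\<in>carrier G. (f \<mu> \<nu> * \<chi> \<nu>) * (?s \<mu> / of_nat (order G)))"
      by (intro sum.cong refl)
        (simp add: R0_coeff fin char_module_K_basis kronecker_scalar_right[OF car ij, unfolded One_nat_def])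
    also have "\<dots> = (\<Sum>\<mu>\<in>carrier G. (\<Sum>\<nu>\<in>carrier G. f \<mu> \<nu> * \<chi> \<nu>) * (?s \<mu> / of_nat (order G)))"
      by (simp only: sum_distrib_right)
    also have "\<dots> = (\<Sum>\<mu>\<in>carrier G. if \<mu> = inv \<zeta> then ?s \<mu> else 0)"
      using order_nonzero
      by (intro sum.cong refl) (simp add: right_transform_orthogonality[OF \<zeta> \<chi>])
    also have "\<dots> = ?s (inv \<zeta>)"
      using fin \<zeta> by simp
    finally show ?thesis .
  qed
  have "tensor_action G (R0 G f) n \<sigma> 1 (char_module G \<chi>) = \<sigma> (K_basis (inv \<zeta>))"
    using car[of "inv \<zeta>"] \<zeta> entry
    by (intro eq_matI) (auto simp: tensor_action_def)
  then show ?thesis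
    using car[of "inv \<zeta>"] \<zeta> by (simp add: braiding_def flip_one_right[unfolded One_nat_def])
qed

text \<open>Both braidings act by single group elements, so the double braiding acts by their product
  \<open>inv \<zeta> \<otimes> inv \<xi>\<close>. The characters \<open>\<lambda>\<mu>. f \<mu> \<eta>\<close> separate this element from \<open>\<one>\<close>, so
  one-dimensional test modules suffice to detect whether it is trivial.\<close>

lemma transparent_iff_transforms_inverse:
  assumes hom: "\<chi> \<in> hom G complex_units"
    and \<xi>: "\<xi> \<in> carrier G" and \<chi>\<xi>: "\<And>\<mu>. \<mu> \<in> carrier G \<Longrightarrow> \<chi> \<mu> = f \<mu> \<xi>"
    and \<zeta>: "\<zeta> \<in> carrier G" and \<chi>\<zeta>: "\<And>\<nu>. \<nu> \<in> carrier G \<Longrightarrow> \<chi> \<nu> = f \<zeta> \<nu>"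
  shows "transparent G (R0 G f) 1 (char_module G \<chi>) \<longleftrightarrow> \<zeta> = inv \<xi>"
proof -
  let ?\<omega> = "inv \<zeta> \<otimes> inv \<xi>"
  have double: "braiding G (R0 G f) n \<sigma> 1 (char_module G \<chi>) *
      braiding G (R0 G f) 1 (char_module G \<chi>) n \<sigma> = \<sigma> (K_basis ?\<omega>)"
    if "is_module G n \<sigma>" for n \<sigma>
    using that \<xi> \<zeta> braiding_character_left[OF that \<xi> \<chi>\<xi>] braiding_character_right[OF that \<zeta> \<chi>\<zeta>]
      is_module_K_mult[OF that] by simp
  have trivial: "?\<omega> = \<one> \<longleftrightarrow> \<zeta> = inv \<xi>"
    using \<xi> \<zeta> inv_equality[of "inv \<zeta>" "inv \<xi>"] by auto
  show ?thesis
  proof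
    assume transp: "transparent G (R0 G f) 1 (char_module G \<chi>)"
    have "f ?\<omega> \<eta> = 1" if \<eta>: "\<eta> \<in> carrier G" for \<eta>
    proof -
      let ?\<sigma> = "char_module G (\<lambda>\<mu>. f \<mu> \<eta>)"
      have "is_module G 1 ?\<sigma>"
        using char_module_is_module[OF fin hom_left[OF \<eta>]] .
      then have "?\<sigma> (K_basis ?\<omega>) = 1\<^sub>m (1 * 1)"
        using transp double unfolding transparent_def by metis
      then have "?\<sigma> (K_basis ?\<omega>) $$ (0, 0) = 1\<^sub>m 1 $$ (0, 0)"
        by simp
      then show ?thesis by (simp add: char_module_K_basis)
    qed
    then show "\<zeta> = inv \<xi>"
      using nondegenerate \<xi> \<zeta> trivial by (simp add: nondegenerate_pairing_def)
  next
    assume "\<zeta> = inv \<xi>"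
    then have "?\<omega> = \<one>" using trivial by simp
    then show "transparent G (R0 G f) 1 (char_module G \<chi>)"
      using double char_module_is_module[OF fin hom] is_module_K_one
      unfolding transparent_def by auto
  qed
qed

lemma Rad0_iff:
  assumes "\<xi> \<in> carrier G"
  shows "\<xi> \<in> Rad0 G f \<longleftrightarrow> (\<forall>\<nu>\<in>carrier G. f \<nu> \<xi> = f (inv \<xi>) \<nu>)"
proof -
  have "f \<xi> \<nu> * f \<nu> \<xi> = 1 \<longleftrightarrow> f \<nu> \<xi> = f (inv \<xi>) \<nu>" if "\<nu> \<in> carrier G" for \<nu>
    using character_inv[OF hom_left[OF that] assms] character_nonzero[OF hom_left[OF that] assms]
    by (metis inverse_unique right_inverse)
  then show ?thesis using assms by (simp add: Rad0_def)
qed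

theorem transparent_iff_transform_of_Rad0:
  assumes hom: "\<chi> \<in> hom G complex_units"
  shows "transparent G (R0 G f) 1 (char_module G \<chi>) \<longleftrightarrow>
         (\<exists>\<xi>\<in>Rad0 G f. \<forall>\<mu>\<in>carrier G. \<chi> \<mu> = f \<mu> \<xi>)"
proof
  assume transp: "transparent G (R0 G f) 1 (char_module G \<chi>)"
  obtain \<xi> where \<xi>: "\<xi> \<in> carrier G" "\<And>\<mu>. \<mu> \<in> carrier G \<Longrightarrow> \<chi> \<mu> = f \<mu> \<xi>"
    using character_as_left_transform[OF hom] by blast
  obtain \<zeta> where \<zeta>: "\<zeta> \<in> carrier G" "\<And>\<nu>. \<nu> \<in> carrier G \<Longrightarrow> \<chi> \<nu> = f \<zeta> \<nu>"
    using character_as_right_transform[OF hom] by blast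
  have "\<zeta> = inv \<xi>"
    using transparent_iff_transforms_inverse[OF hom \<xi> \<zeta>] transp by blast
  then have "\<xi> \<in> Rad0 G f"
    using Rad0_iff[OF \<xi>(1)] \<xi>(2) \<zeta>(2) by metis
  then show "\<exists>\<xi>\<in>Rad0 G f. \<forall>\<mu>\<in>carrier G. \<chi> \<mu> = f \<mu> \<xi>"
    using \<xi>(2) by blast
next
  assume "\<exists>\<xi>\<in>Rad0 G f. \<forall>\<mu>\<in>carrier G. \<chi> \<mu> = f \<mu> \<xi>"
  then obtain \<xi> where \<xi>: "\<xi> \<in> Rad0 G f" "\<And>\<mu>. \<mu> \<in> carrier G \<Longrightarrow> \<chi> \<mu> = f \<mu> \<xi>"
    by blast
  then have car: "\<xi> \<in> carrier G" by (simp add: Rad0_def)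
  have "\<chi> \<nu> = f (inv \<xi>) \<nu>" if "\<nu> \<in> carrier G" for \<nu>
    using \<xi> Rad0_iff[OF car] that by simp
  then show "transparent G (R0 G f) 1 (char_module G \<chi>)"
    using transparent_iff_transforms_inverse[OF hom car \<xi>(2) inv_closed[OF car]] by blast
qed

end

section \<open>Quotients of lattices of weights\<close>

lemma dual_group_comm_group: "comm_group (dual_group scale H)"
proof (rule comm_groupI)
  fix x assume "x \<in> carrier (dual_group scale H)"
  then show "\<exists>y\<in>carrier (dual_group scale H).
      y \<otimes>\<^bsub>dual_group scale H\<^esub> x = \<one>\<^bsub>dual_group scale H\<^esub>"
    by (intro bexI[of _ "\<lambda>h. - x h"]) (auto simp: dual_group_def dual_space_def)
qed (auto simp: dual_group_def dual_space_def algebra_simps)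

lemma lattice_quotient_comm_group:
  assumes L: "subgroup L (dual_group scale H)" and L': "subgroup L' (dual_group scale H)"
    and "L' \<subseteq> L"
  shows "comm_group (lattice_quotient scale H L L')"
proof -
  interpret D: comm_group "dual_group scale H" by (rule dual_group_comm_group)
  interpret DL: comm_group "(dual_group scale H)\<lparr>carrier := L\<rparr>"
    using group.group_comm_groupI[OF subgroup.subgroup_is_group[OF L D.group_axioms]]
      D.m_comm subgroup.mem_carrier[OF L] by simp
  have "subgroup L' ((dual_group scale H)\<lparr>carrier := L\<rparr>)"
    using D.subgroup_incl[OF L' L assms(3)] .
  then show ?thesis
    unfolding lattice_quotient_def by (rule DL.abelian_FactGroup)
qed

theorem lemma5p19:
  fixes scale :: "complex \<Rightarrow> 'g::ab_group_add \<Rightarrow> 'g"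
    and bracket :: "'g \<Rightarrow> 'g \<Rightarrow> 'g"
    and H :: "'g set"
    and L L' :: "('g \<Rightarrow> complex) set"
    and G :: "('g \<Rightarrow> complex) set monoid"
    and f :: "('g \<Rightarrow> complex) set \<Rightarrow> ('g \<Rightarrow> complex) set \<Rightarrow> complex"
    and \<chi> :: "('g \<Rightarrow> complex) set \<Rightarrow> complex"
  assumes "simple_complex_lie_algebra scale bracket"
    and "cartan_subalgebra scale bracket H"
    and "subgroup L (dual_group scale H)"
    and "root_lattice scale bracket H \<subseteq> L"
    and "L \<subseteq> weight_lattice scale bracket H"
    and "subgroup L' (dual_group scale H)"
    and "L' \<subseteq> root_lattice scale bracket H"
    and "G = lattice_quotient scale H L L'"
    and "finite (carrier G)"
    and "is_group_pairing G f"
    and "nondegenerate_pairing G f"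
    and "\<chi> \<in> hom G complex_units"
  shows "transparent G (R0 G f) 1 (char_module G \<chi>) \<longleftrightarrow>
         (\<exists>\<xi> \<in> Rad0 G f. \<forall>\<mu> \<in> carrier G. \<chi> \<mu> = f \<mu> \<xi>)"
proof -
  have "comm_group G"
    using lattice_quotient_comm_group[OF assms(3) assms(6)] assms(4,7,8) by blast
  then interpret finite_group_pairing G f
    using assms(9-11) by (simp add: finite_group_pairing_def finite_group_pairing_axioms_def)
  show ?thesis
    using transparent_iff_transform_of_Rad0[OF assms(12)] .
qed

end
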